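(* Let $G$ be a finite simple graph and let $D \subseteq V(G)$ be a connected two-way dominating set of $G$. Then $$ rc(G) \leq rc(G[D]) + 3. $$
   Context: All graphs are finite, simple and undirected. An edge colouring of a graph is a map from its edge set to the natural numbers. A path is a rainbow path if no two of its edges have the same colour. An edge-coloured graph is rainbow connected if every pair of vertices is joined by at least one rainbow path. The rainbow connection number $rc(G)$ of a connected graph $G$ is the minimum number of colours in an edge colouring making $G$ rainbow connected. $G[S]$ denotes the subgraph induced on $S$. A set $D \subseteq V(G)$ is dominating if every vertex of $G$ is in $D$ or adjacent to a vertex of $D$. A pendant vertex is a vertex of degree $1$. A dominating set $D$ is a two-way dominating set if every pendant vertex of $G$ belongs to $D$; it is a connected two-way dominating set if in addition $G[D]$ is connected. *)

theory Defs
  imports "Graph_Theory.Graph_Theory"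
begin

text \<open>
  A finite simple undirected graph is an instance of the locale \<^locale>\<open>graph\<close>: a finite
  loop-free symmetric digraph without parallel arcs. An undirected edge is then a pair of
  mutually inverse arcs; we represent it by its set of end vertices, so that a colouring of
  undirected edges gives both arcs the same colour.
\<close>

definition uedge :: "('a, 'b) pre_digraph \<Rightarrow> 'b \<Rightarrow> 'a set" where
  "uedge G e = {tail G e, head G e}"

definition uedges :: "('a, 'b) pre_digraph \<Rightarrow> 'a set set" where
  "uedges G = uedge G ` arcs G"

text \<open>Only the values of a colouring \<open>c\<close> on \<^term>\<open>uedges G\<close> matter below.\<close>

definition rainbow_path ::
    "('a, 'b) pre_digraph \<Rightarrow> ('a set \<Rightarrow> nat) \<Rightarrow> 'a \<Rightarrow> 'b awalk \<Rightarrow> 'a \<Rightarrow> bool" where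
  "rainbow_path G c u p v \<longleftrightarrow>
     pre_digraph.apath G u p v \<and> distinct (map (\<lambda>e. c (uedge G e)) p)"

definition rainbow_connected :: "('a, 'b) pre_digraph \<Rightarrow> ('a set \<Rightarrow> nat) \<Rightarrow> bool" where
  "rainbow_connected G c \<longleftrightarrow>
     (\<forall>u \<in> verts G. \<forall>v \<in> verts G. \<exists>p. rainbow_path G c u p v)"

text \<open>
  The number is meaningful for connected finite graphs only; there the minimum is attained,
  see \<open>rc_attained\<close> below.
\<close>

definition rc :: "('a, 'b) pre_digraph \<Rightarrow> nat" where
  "rc G = (LEAST k. \<exists>c. rainbow_connected G c \<and> card (c ` uedges G) = k)"

definition dominating :: "('a, 'b) pre_digraph \<Rightarrow> 'a set \<Rightarrow> bool" where
  "dominating G D \<longleftrightarrow>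
     D \<subseteq> verts G \<and> (\<forall>v \<in> verts G. v \<in> D \<or> (\<exists>w \<in> D. v \<rightarrow>\<^bsub>G\<^esub> w))"

text \<open>
  In a symmetric digraph the degree of the undirected graph is the out-degree, see
  \<open>out_degree_eq_card_uedges\<close> below.
\<close>

definition pendant :: "('a, 'b) pre_digraph \<Rightarrow> 'a \<Rightarrow> bool" where
  "pendant G v \<longleftrightarrow> v \<in> verts G \<and> out_degree G v = 1"

definition two_way_dominating :: "('a, 'b) pre_digraph \<Rightarrow> 'a set \<Rightarrow> bool" where
  "two_way_dominating G D \<longleftrightarrow> dominating G D \<and> (\<forall>v. pendant G v \<longrightarrow> v \<in> D)"

definition connected_two_way_dominating :: "('a, 'b) pre_digraph \<Rightarrow> 'a set \<Rightarrow> bool" where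
  "connected_two_way_dominating G D \<longleftrightarrow> two_way_dominating G D \<and> connected (G \<restriction> D)"

lemma (in graph) out_degree_eq_card_uedges:
  "out_degree G v = card {E \<in> uedges G. v \<in> E}"
proof -
  have inj: "inj_on (uedge G) (out_arcs G v)"
  proof (rule inj_onI)
    fix e f assume "e \<in> out_arcs G v" "f \<in> out_arcs G v" "uedge G e = uedge G f"
    moreover from this have "head G e = head G f"
      by (auto simp: uedge_def doubleton_eq_iff)
    ultimately show "e = f"
      using no_multi_arcs[of e f] by (auto simp: arc_to_ends_def)
  qed
  have "uedge G ` out_arcs G v = {E \<in> uedges G. v \<in> E}"
  proof
    show "uedge G ` out_arcs G v \<subseteq> {E \<in> uedges G. v \<in> E}"
      by (auto simp: uedges_def uedge_def)
    show "{E \<in> uedges G. v \<in> E} \<subseteq> uedge G ` out_arcs G v"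
    proof
      fix E assume "E \<in> {E \<in> uedges G. v \<in> E}"
      then obtain e where e: "e \<in> arcs G" "E = uedge G e" "v \<in> uedge G e"
        by (auto simp: uedges_def)
      obtain f where f: "f \<in> arcs G" "tail G e = head G f" "head G e = tail G f"
        using sym_arcs e(1) unfolding symmetric_conv by blast
      show "E \<in> uedge G ` out_arcs G v"
      proof (cases "v = tail G e")
        case True with e show ?thesis by auto
      next
        case False
        with e f have "f \<in> out_arcs G v" "E = uedge G f" by (auto simp: uedge_def)
        then show ?thesis by blast
      qed
    qed
  qed
  with card_image[OF inj] show ?thesis by (simp add: out_degree_def)
qed

lemma (in graph) distinct_uedges_apath:
  assumes "apath u p v"
  shows "distinct (map (uedge G) p)"
  using assms
proof (induction p arbitrary: u)
  case (Cons e p)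
  then have ap: "apath (head G e) p v" and u: "u = tail G e"
    "tail G e \<notin> set (awalk_verts (head G e) p)"
    by (auto simp: apath_Cons_iff)
  have "uedge G e \<noteq> uedge G f" if "f \<in> set p" for f
  proof -
    from ap have "awalk (head G e) p v" by (simp add: apath_def)
    then have "tail G f \<in> set (awalk_verts (head G e) p)"
      "head G f \<in> set (awalk_verts (head G e) p)"
      using that awalk_verts_arc1 awalk_verts_arc2 by blast+
    with u(2) show ?thesis by (auto simp: uedge_def doubleton_eq_iff)
  qed
  with Cons.IH[OF ap] show ?case by auto
qed simp

lemma (in graph) rc_attained:
  assumes "connected G"
  obtains c where "rainbow_connected G c" "card (c ` uedges G) = rc G"
proof -
  have "finite (uedges G)" by (simp add: uedges_def)
  then obtain c :: "'a set \<Rightarrow> nat" where c: "inj_on c (uedges G)"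
    using finite_imp_inj_to_nat_seg by blast
  have "rainbow_connected G c"
    unfolding rainbow_connected_def
  proof (intro ballI)
    fix u v assume "u \<in> verts G" "v \<in> verts G"
    moreover have "strongly_connected G"
      using sym_arcs assms by (rule symmetric_connected_imp_strongly_connected)
    ultimately have "u \<rightarrow>\<^sup>* v" by (auto simp: strongly_connected_def)
    then obtain p where p: "apath u p v" by (auto simp: reachable_apath)
    then have "uedge G ` set p \<subseteq> uedges G"
      by (auto simp: apath_def awalk_def uedges_def)
    then have "distinct (map c (map (uedge G) p))"
      using distinct_uedges_apath[OF p] c
      by (subst distinct_map) (auto intro: inj_on_subset)
    with p show "\<exists>p. rainbow_path G c u p v"
      by (auto simp: rainbow_path_def comp_def)
  qed
  then have "\<exists>k c. rainbow_connected G c \<and> card (c ` uedges G) = k" by blast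
  from LeastI_ex[OF this] that show ?thesis unfolding rc_def by blast
qed

end

theory Submission
  imports Defs
begin

text \<open>
  Let \<open>W\<close> be the complement of \<open>D\<close> and \<open>I\<close> a maximal independent set of \<open>G[W]\<close>. Choose a
  neighbour \<open>f v\<close> in \<open>D\<close> for every \<open>v\<close> in \<open>W\<close>. Keep an optimal colouring on \<open>G[D]\<close> and use
  three new colours: the first one on the edges \<open>{v, f v}\<close> with \<open>v\<close> in \<open>I\<close>, the second one on
  all other edges between \<open>W\<close> and \<open>D\<close>, and the third one inside \<open>W\<close>. A vertex outside \<open>I\<close>
  enters \<open>D\<close> with the second colour, or with the third and then the first one through a
  neighbour in \<open>I\<close>. A vertex of \<open>I\<close> enters \<open>D\<close> with the first colour; as it is not pendant it
  has a neighbour other than \<open>f v\<close>, through which it enters \<open>D\<close> with the second colour,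
  possibly after an edge inside \<open>W\<close>. So any two vertices of \<open>W\<close> can enter \<open>D\<close> with different
  colours, using the third colour at most once.
\<close>

text \<open>\<open>U\<close> and \<open>C\<close> are upper bounds for the vertices and colours in
  use, so a path can be prolonged by one edge without naming it.\<close>

definition rainbow_joined ::
    "('a, 'b) pre_digraph \<Rightarrow> ('a set \<Rightarrow> nat) \<Rightarrow> 'a set \<Rightarrow> nat set \<Rightarrow> 'a \<Rightarrow> 'a \<Rightarrow> bool" where
  "rainbow_joined G c U C u v \<longleftrightarrow>
     (\<exists>p. rainbow_path G c u p v \<and> set (pre_digraph.awalk_verts G u p) \<subseteq> U \<and>
          (\<lambda>e. c (uedge G e)) ` set p \<subseteq> C)"

section \<open>Extending rainbow paths by one edge\<close>

context graph
begin

lemma dominates_neq: "u \<rightarrow>\<^bsub>G\<^esub> v \<Longrightarrow> u \<noteq> v"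
  using no_loops by (auto simp: arcs_ends_def arc_to_ends_def)

lemma rainbow_joined_refl: "u \<in> verts G \<Longrightarrow> u \<in> U \<Longrightarrow> rainbow_joined G c U C u u"
  unfolding rainbow_joined_def by (rule exI[of _ "[]"]) (auto simp: rainbow_path_def apath_Nil_iff)

lemma rainbow_joined_Cons:
  assumes "rainbow_joined G c U C u v" "x \<rightarrow>\<^bsub>G\<^esub> u" "x \<notin> U" "c {x, u} \<notin> C"
  shows "rainbow_joined G c (insert x U) (insert (c {x, u}) C) x v"
proof -
  obtain p where p: "apath u p v" "distinct (map (\<lambda>e. c (uedge G e)) p)"
      "set (awalk_verts u p) \<subseteq> U" "(\<lambda>e. c (uedge G e)) ` set p \<subseteq> C"
    using assms(1) by (auto simp: rainbow_joined_def rainbow_path_def)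
  obtain e where e: "e \<in> arcs G" "tail G e = x" "head G e = u"
    using assms(2) by (auto simp: arcs_ends_def arc_to_ends_def)
  have "apath x (e # p) v"
    using p e assms(3) by (auto simp: apath_Cons_iff)
  moreover have "distinct (map (\<lambda>e. c (uedge G e)) (e # p))"
    using p e assms(4) by (auto simp: uedge_def)
  moreover have "set (awalk_verts x (e # p)) \<subseteq> insert x U"
    using p e by auto
  moreover have "(\<lambda>e. c (uedge G e)) ` set (e # p) \<subseteq> insert (c {x, u}) C"
    using p e by (auto simp: uedge_def)
  ultimately show ?thesis
    unfolding rainbow_joined_def rainbow_path_def by blast
qed

lemma rainbow_joined_snoc:
  assumes "rainbow_joined G c U C u v" "v \<rightarrow>\<^bsub>G\<^esub> x" "x \<notin> U" "c {v, x} \<notin> C"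
  shows "rainbow_joined G c (insert x U) (insert (c {v, x}) C) u x"
proof -
  obtain p where p: "apath u p v" "distinct (map (\<lambda>e. c (uedge G e)) p)"
      "set (awalk_verts u p) \<subseteq> U" "(\<lambda>e. c (uedge G e)) ` set p \<subseteq> C"
    using assms(1) by (auto simp: rainbow_joined_def rainbow_path_def)
  obtain e where e: "e \<in> arcs G" "tail G e = v" "head G e = x"
    using assms(2) by (auto simp: arcs_ends_def arc_to_ends_def)
  have last: "awlast u p = v" and wp: "awalk u p v" using p(1) by (auto simp: apath_def)
  have we: "awalk v [e] x" using e by (auto simp: awalk_Cons_iff awalk_Nil_iff)
  have w: "awalk u (p @ [e]) x" using wp we last by simp
  \<comment> \<open>The new arc contributes exactly its head, so \<open>x \<notin> U\<close> keeps
    the vertices distinct.\<close>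
  have vs: "awalk_verts u (p @ [e]) = awalk_verts u p @ [x]"
    using awalk_verts_append[OF w] last e by simp
  have "apath u (p @ [e]) x"
    using w vs p assms(3) by (auto simp: apath_def)
  moreover have "distinct (map (\<lambda>e. c (uedge G e)) (p @ [e]))"
    using p e assms(4) by (auto simp: uedge_def)
  moreover have "set (awalk_verts u (p @ [e])) \<subseteq> insert x U"
    using p vs by auto
  moreover have "(\<lambda>e. c (uedge G e)) ` set (p @ [e]) \<subseteq> insert (c {v, x}) C"
    using p e by (auto simp: uedge_def)
  ultimately show ?thesis
    unfolding rainbow_joined_def rainbow_path_def by blast
qed

section \<open>Transfer from an induced subgraph\<close>

lemma graph_induce_subgraph:
  assumes "D \<subseteq> verts G"
  shows "graph (G \<restriction> D)"
proof -
  have "induced_subgraph (G \<restriction> D) G" using assms by (rule induced_induce)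
  then have "digraph (G \<restriction> D)" "sym_digraph (G \<restriction> D)"
    by (rule digraphI_induced, rule induced_graph_imp_graph)
  then show ?thesis by (simp add: graph_def pseudo_graph_def digraph_def)
qed

text \<open>Carries the rainbow paths inside \<open>D\<close> over to a colouring of
  \<open>G\<close> that agrees with the old one only on the edges of the induced subgraph.\<close>

lemma rainbow_joined_induce_subgraph:
  assumes "D \<subseteq> verts G" "rainbow_path (G \<restriction> D) c u p v"
    and "\<And>E. E \<in> uedges (G \<restriction> D) \<Longrightarrow> c' E = c E"
  shows "rainbow_joined G c' D (c ` uedges (G \<restriction> D)) u v"
proof -
  have ap: "pre_digraph.apath (G \<restriction> D) u p v"
    and dist: "distinct (map (\<lambda>e. c (uedge (G \<restriction> D) e)) p)"
    using assms(2) by (auto simp: rainbow_path_def)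
  have sub: "subgraph (G \<restriction> D) G"
    using assms(1) by (intro induced_imp_subgraph induced_induce)
  interpret H: wf_digraph "G \<restriction> D" by (rule wellformed_induce_subgraph)
  have wH: "H.awalk u p v" using ap by (simp add: H.apath_def)
  have "set p \<subseteq> arcs (G \<restriction> D)" using wH by (auto simp: H.awalk_def)
  then have col: "c' (uedge G e) = c (uedge (G \<restriction> D) e)" if "e \<in> set p" for e
    using that assms(3)[of "uedge (G \<restriction> D) e"] by (auto simp: uedges_def uedge_def)
  have "apath u p v" using subgraph_apath_imp_apath[OF ap sub] .
  moreover have "awalk_verts u p = H.awalk_verts u p"
    by (simp add: pre_digraph.awalk_verts_conv)
  then have "set (awalk_verts u p) \<subseteq> D"
    using wH H.awalk_verts_in_verts[of u p] by (auto simp: H.awalk_def)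
  moreover have "distinct (map (\<lambda>e. c' (uedge G e)) p)"
    using dist col by (simp cong: map_cong)
  moreover have "(\<lambda>e. c' (uedge G e)) ` set p \<subseteq> c ` uedges (G \<restriction> D)"
    using col \<open>set p \<subseteq> arcs (G \<restriction> D)\<close> unfolding uedges_def image_image
    by (intro image_subsetI) (metis imageI subsetD)
  ultimately show ?thesis
    unfolding rainbow_joined_def rainbow_path_def by blast
qed

section \<open>Independent sets, second neighbours, bounding \<open>rc\<close>\<close>

lemma ex_maximal_independent_set:
  assumes "finite W"
  obtains I where "I \<subseteq> W" "\<And>u v. u \<in> I \<Longrightarrow> v \<in> I \<Longrightarrow> \<not> u \<rightarrow>\<^bsub>G\<^esub> v"
    "\<And>v. v \<in> W - I \<Longrightarrow> \<exists>u\<in>I. v \<rightarrow>\<^bsub>G\<^esub> u"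
proof -
  let ?S = "{J. J \<subseteq> W \<and> (\<forall>u\<in>J. \<forall>v\<in>J. \<not> u \<rightarrow>\<^bsub>G\<^esub> v)}"
  have "finite ?S" "?S \<noteq> {}" using assms by auto
  then have "\<exists>I\<in>?S. \<forall>J\<in>?S. I \<subseteq> J \<longrightarrow> I = J" by (rule finite_has_maximal)
  then obtain I where I: "I \<in> ?S" "\<forall>J\<in>?S. I \<subseteq> J \<longrightarrow> I = J" ..
  show ?thesis
  proof (rule that)
    show "I \<subseteq> W" "\<And>u v. u \<in> I \<Longrightarrow> v \<in> I \<Longrightarrow> \<not> u \<rightarrow>\<^bsub>G\<^esub> v" using I(1) by auto
    show "\<exists>u\<in>I. v \<rightarrow>\<^bsub>G\<^esub> u" if v: "v \<in> W - I" for v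
    proof (rule ccontr)
      assume "\<not> (\<exists>u\<in>I. v \<rightarrow>\<^bsub>G\<^esub> u)"
      \<comment> \<open>A vertex with no neighbour in \<open>I\<close> could be added to
        \<open>I\<close>, against maximality.\<close>
      then have "insert v I \<in> ?S"
        using v I(1) graph_symmetric dominates_neq[of v v] by auto
      from bspec[OF I(2) this] have "I = insert v I" by (rule mp) (rule subset_insertI)
      with v show False by blast
    qed
  qed
qed

lemma not_pendant_other_neighbour:
  assumes "v \<in> verts G" "\<not> pendant G v" "v \<rightarrow>\<^bsub>G\<^esub> w"
  obtains w' where "v \<rightarrow>\<^bsub>G\<^esub> w'" "w' \<noteq> w"
proof -
  obtain e where e: "e \<in> arcs G" "tail G e = v" "head G e = w"
    using assms(3) by (auto simp: arcs_ends_def arc_to_ends_def)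
  \<comment> \<open>Out-degree different from 1 forces a second arc at \<open>v\<close>; without
    parallel arcs its head differs from \<open>w\<close>.\<close>
  have "out_arcs G v \<noteq> {e}"
    using assms(1,2) by (auto simp: pendant_def out_degree_def)
  then obtain e' where e': "e' \<in> arcs G" "tail G e' = v" "e' \<noteq> e"
    using e by (auto simp: set_eq_iff)
  then have "head G e' \<noteq> w"
    using no_multi_arcs[of e e'] e by (auto simp: arc_to_ends_def)
  moreover have "v \<rightarrow>\<^bsub>G\<^esub> head G e'"
    using e' by (auto intro: dominatesI simp: arc_to_ends_def)
  ultimately show ?thesis using that by blast
qed

lemma rc_le:
  assumes "rainbow_connected G c" "c ` uedges G \<subseteq> C" "finite C"
  shows "rc G \<le> card C"
proof -
  have "rc G \<le> card (c ` uedges G)"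
    unfolding rc_def using assms(1) by (intro Least_le) blast
  also have "\<dots> \<le> card C" using assms(2,3) by (rule card_mono[rotated])
  finally show ?thesis .
qed

section \<open>The colouring with three new colours\<close>

lemma rc_le_dominating:
  assumes "connected_two_way_dominating G D"
  shows "rc G \<le> rc (G \<restriction> D) + 3"
proof -
  define W where "W = verts G - D"
  have DV: "D \<subseteq> verts G" and "connected (G \<restriction> D)"
    and foot: "\<forall>v\<in>W. \<exists>w\<in>D. v \<rightarrow>\<^bsub>G\<^esub> w" and notpend: "\<And>v. v \<in> W \<Longrightarrow> \<not> pendant G v"
    using assms by (auto simp: connected_two_way_dominating_def two_way_dominating_def
        dominating_def W_def)
  interpret H: graph "G \<restriction> D"
    using DV by (rule graph_induce_subgraph)
  obtain c where c: "rainbow_connected (G \<restriction> D) c"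
      "card (c ` uedges (G \<restriction> D)) = rc (G \<restriction> D)"
    using H.rc_attained[OF \<open>connected (G \<restriction> D)\<close>] .
  define B where "B = c ` uedges (G \<restriction> D)"
  have finB: "finite B" by (simp add: B_def uedges_def)
  \<comment> \<open>Any strict upper bound of the old colours makes \<open>m\<close>,
    \<open>m + 1\<close>, \<open>m + 2\<close> new.\<close>
  then obtain m where m: "\<And>b. b \<in> B \<Longrightarrow> b < m"
    using finite_nat_set_iff_bounded by metis
  obtain f where f: "\<And>v. v \<in> W \<Longrightarrow> f v \<in> D" "\<And>v. v \<in> W \<Longrightarrow> v \<rightarrow>\<^bsub>G\<^esub> f v"
    using foot by metis
  have "finite W" by (simp add: W_def)
  then obtain I where I: "I \<subseteq> W" "\<And>u v. u \<in> I \<Longrightarrow> v \<in> I \<Longrightarrow> \<not> u \<rightarrow>\<^bsub>G\<^esub> v"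
      "\<And>v. v \<in> W - I \<Longrightarrow> \<exists>u\<in>I. v \<rightarrow>\<^bsub>G\<^esub> u"
    using ex_maximal_independent_set by metis
  define c' where "c' E = (if E \<subseteq> D then c E else if E \<subseteq> W then m + 2
      else if \<exists>v\<in>I. E = {v, f v} then m else m + 1)" for E
  have WD: "x \<notin> D" if "x \<in> W" for x using that by (simp add: W_def)
  have new: "m \<notin> B" "m + 1 \<notin> B" "m + 2 \<notin> B" using m by fastforce+
  have c'W: "c' {x, y} = m + 2" if "x \<in> W" "y \<in> W" for x y
    using that WD by (simp add: c'_def)
  have c'WD: "c' {x, w} = (if x \<in> I \<and> w = f x then m else m + 1)"
    if "x \<in> W" "w \<in> D" for x w
  proof -
    \<comment> \<open>As \<open>W\<close> and \<open>D\<close> are disjoint, a witness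
      \<open>v\<close> in \<open>W\<close> with \<open>f v\<close> in \<open>D\<close> must be
      \<open>x\<close> itself.\<close>
    have "(\<exists>v\<in>I. {x, w} = {v, f v}) \<longleftrightarrow> x \<in> I \<and> w = f x"
      using that WD I(1) f(1) by (auto simp: doubleton_eq_iff)
    then show ?thesis using that WD by (auto simp: c'_def)
  qed
  have c'DW: "c' {w, x} = (if x \<in> I \<and> w = f x then m else m + 1)"
    if "x \<in> W" "w \<in> D" for x w
    using c'WD[OF that] by (simp add: insert_commute)

  have "rainbow_joined G c' D B u v" if "u \<in> D" "v \<in> D" for u v
  proof -
    obtain p where "rainbow_path (G \<restriction> D) c u p v"
      using c(1) \<open>u \<in> D\<close> \<open>v \<in> D\<close> by (auto simp: rainbow_connected_def)
    moreover have "c' E = c E" if "E \<in> uedges (G \<restriction> D)" for E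
      using that by (auto simp: c'_def uedges_def uedge_def)
    ultimately show ?thesis
      unfolding B_def using DV by (intro rainbow_joined_induce_subgraph)
  qed
  note joinD = this
  have joinW: "rainbow_joined G c' (insert x D) (insert (c' {x, w}) B) x v"
    if "x \<in> W" "v \<in> D" "w \<in> D" "x \<rightarrow>\<^bsub>G\<^esub> w" for x v w
    using that new WD by (intro rainbow_joined_Cons joinD) (auto simp: c'WD)
  \<comment> \<open>The path runs from \<open>x\<close> to \<open>w\<close>, inside \<open>D\<close>
    to \<open>z\<close>, then to \<open>y\<close>; \<open>w = z\<close> is allowed.\<close>
  have joinWW: "rainbow_joined G c' (insert y (insert x D)) (insert m (insert (m + 1) B)) x y"
    if "x \<in> W" "y \<in> W" "x \<noteq> y" "w \<in> D" "x \<rightarrow>\<^bsub>G\<^esub> w" "z \<in> D" "y \<rightarrow>\<^bsub>G\<^esub> z" "c' {x, w} \<noteq> c' {y, z}"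
    for x y w z
  proof -
    have "rainbow_joined G c' (insert y (insert x D))
        (insert (c' {z, y}) (insert (c' {x, w}) B)) x y"
    proof (rule rainbow_joined_snoc)
      show "rainbow_joined G c' (insert x D) (insert (c' {x, w}) B) x z"
        using that by (intro joinW)
      show "z \<rightarrow>\<^bsub>G\<^esub> y" using \<open>y \<rightarrow>\<^bsub>G\<^esub> z\<close> by (rule graph_symmetric)
      show "y \<notin> insert x D" using that WD by auto
      show "c' {z, y} \<notin> insert (c' {x, w}) B"
        using that new by (auto simp: c'WD c'DW split: if_splits)
    qed
    \<comment> \<open>Edges between \<open>W\<close> and \<open>D\<close> have only these two
      colours, so two different ones exhaust them, in either order.\<close>
    moreover have "{c' {z, y}, c' {x, w}} = {m, m + 1}"
      using that by (auto simp: c'WD c'DW split: if_splits)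
    then have "insert (c' {z, y}) (insert (c' {x, w}) B) = insert m (insert (m + 1) B)"
      by (metis insert_is_Un Un_insert_left)
    ultimately show ?thesis by simp
  qed
  \<comment> \<open>A detour through \<open>x'\<close> puts one edge inside \<open>W\<close>, of
    colour \<open>m + 2\<close>, before a path of the previous kind.\<close>
  have joinWWW: "rainbow_joined G c' (insert x (insert y (insert x' D)))
      (insert (m + 2) (insert m (insert (m + 1) B))) x y"
    if "x \<in> W" "x' \<in> W" "x \<rightarrow>\<^bsub>G\<^esub> x'" "x \<noteq> y" "x' \<noteq> y" "y \<in> W"
      "w \<in> D" "x' \<rightarrow>\<^bsub>G\<^esub> w" "z \<in> D" "y \<rightarrow>\<^bsub>G\<^esub> z" "c' {x', w} \<noteq> c' {y, z}" for x x' y w z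
  proof -
    have "rainbow_joined G c' (insert x (insert y (insert x' D)))
        (insert (c' {x, x'}) (insert m (insert (m + 1) B))) x y"
    proof (rule rainbow_joined_Cons)
      show "rainbow_joined G c' (insert y (insert x' D)) (insert m (insert (m + 1) B)) x' y"
        using that by (intro joinWW[of x' y w z])
      show "x \<rightarrow>\<^bsub>G\<^esub> x'" by fact
      show "x \<notin> insert y (insert x' D)" using that WD dominates_neq[of x x'] by auto
      show "c' {x, x'} \<notin> insert m (insert (m + 1) B)" using that new by (simp add: c'W)
    qed
    with c'W[OF that(1,2)] show ?thesis by simp
  qed

  have "\<exists>U C. rainbow_joined G c' U C x y" if V: "x \<in> verts G" "y \<in> verts G" for x y
  proof -
    consider "x = y" | "x \<in> D" "y \<in> D" | "x \<in> W" "y \<in> D" | "x \<in> D" "y \<in> W"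
      | "x \<in> W" "y \<in> W" "x \<noteq> y"
      using V by (auto simp: W_def)
    then show ?thesis
    proof cases
      case 1
      with V show ?thesis using rainbow_joined_refl by blast
    next
      case 2
      with joinD show ?thesis by blast
    next
      case 3
      with joinW f show ?thesis by blast
    next
      case 4
      have "rainbow_joined G c' (insert y D) (insert (c' {f y, y}) B) x y"
        using 4 new WD f
        by (intro rainbow_joined_snoc joinD graph_symmetric[of y "f y"]) (auto simp: c'DW)
      then show ?thesis by blast
    next
      case 5
      note xy = this
      show ?thesis
      proof (cases "x \<in> I \<longleftrightarrow> y \<in> I")
        case False
        with xy f have "c' {x, f x} \<noteq> c' {y, f y}" by (auto simp: c'WD)
        with xy f joinWW[of x y "f x" "f y"] show ?thesis by blast
      next
        case same: True
        show ?thesis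
        proof (cases "x \<in> I")
          case True
          \<comment> \<open>Both ends lie in \<open>I\<close> and \<open>y\<close> uses
            \<open>m\<close>, so \<open>x\<close> has to enter \<open>D\<close> with
            \<open>m + 1\<close>: directly if \<open>w\<close> is in \<open>D\<close>, and otherwise
            through \<open>w\<close>, which independence keeps out of \<open>I\<close>.\<close>
          obtain w where w: "x \<rightarrow>\<^bsub>G\<^esub> w" "w \<noteq> f x"
            using not_pendant_other_neighbour[of x "f x"] xy(1) notpend f by (auto simp: W_def)
          then have "w \<in> verts G" by auto
          show ?thesis
          proof (cases "w \<in> D")
            case True
            then have "c' {x, w} \<noteq> c' {y, f y}"
              using xy f w same \<open>x \<in> I\<close> by (auto simp: c'WD)
            with xy f w True joinWW[of x y w "f y"] show ?thesis by blast
          next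
            case False
            with \<open>w \<in> verts G\<close> have "w \<in> W" by (simp add: W_def)
            moreover have "w \<notin> I" using I(2) True w by blast
            moreover have "w \<noteq> y" using \<open>w \<notin> I\<close> True same by blast
            moreover have "c' {w, f w} \<noteq> c' {y, f y}"
              using xy f \<open>w \<in> W\<close> \<open>w \<notin> I\<close> same True by (auto simp: c'WD)
            ultimately show ?thesis
              using xy f w joinWWW[of x w y "f w" "f y"] by blast
          qed
        next
          case False
          \<comment> \<open>Neither end lies in \<open>I\<close>: \<open>y\<close> uses
            \<open>m + 1\<close>, and \<open>x\<close> reaches \<open>D\<close> with
            \<open>m\<close> through \<open>w\<close>.\<close>
          then obtain w where w: "w \<in> I" "x \<rightarrow>\<^bsub>G\<^esub> w" using I(3) xy by blast
          then have "w \<in> W" "w \<noteq> y" using I(1) same False by auto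
          moreover have "c' {w, f w} \<noteq> c' {y, f y}"
            using xy f \<open>w \<in> W\<close> w same False by (auto simp: c'WD)
          ultimately show ?thesis
            using xy f w joinWWW[of x w y "f w" "f y"] by blast
        qed
      qed
    qed
  qed
  then have "rainbow_connected G c'"
    unfolding rainbow_connected_def rainbow_joined_def by blast
  moreover have "c' ` uedges G \<subseteq> B \<union> {m, m + 1, m + 2}"
  proof -
    \<comment> \<open>Edges of \<open>G\<close> inside \<open>D\<close> are edges of the induced
      subgraph, so their colours lie in \<open>B\<close>.\<close>
    have "E \<in> uedges (G \<restriction> D)" if "E \<in> uedges G" "E \<subseteq> D" for E
      using that by (auto simp: uedges_def uedge_def)
    then show ?thesis by (auto simp: c'_def B_def)
  qed
  ultimately have "rc G \<le> card (B \<union> {m, m + 1, m + 2})"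
    using finB by (intro rc_le) auto
  also have "\<dots> \<le> card B + card {m, m + 1, m + 2}" by (rule card_Un_le)
  also have "\<dots> = rc (G \<restriction> D) + 3" using c(2) by (simp add: B_def)
  finally show ?thesis .
qed

end

theorem theorem1:
  fixes G :: "('a, 'b) pre_digraph" and D :: "'a set"
  assumes "graph G"
    and "connected_two_way_dominating G D"
  shows "rc G \<le> rc (G \<restriction> D) + 3"
  using assms by (rule graph.rc_le_dominating)

end
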